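(* Let $\mathfrak h$ be a Lie algebra, and define $f_0:\mathrm{Der}(\mathfrak h)\to\Pi(\mathfrak h)$ by $f_0(D)=(D,-D)$. Then $(f_0,f_1=\mathrm{id},f_2=0)$ is an isomorphism from the Lie 2-algebra $(\mathfrak h,\mathrm{Der}(\mathfrak h),\mathrm{ad},l_2)$ to the Lie 2-algebra $(\mathfrak h,\Pi(\mathfrak h),(\mathrm{ad}^L,\mathrm{ad}^R),l_2)$.
   Context: All vector spaces are over a fixed ground field. A (left) Leibniz algebra is a vector space with a bilinear bracket satisfying $[x,[y,z]]=[[x,y],z]+[y,[x,z]]$; a Lie algebra is in particular a Leibniz algebra. For a Leibniz algebra $\mathfrak h$: $\mathrm{ad}^L_\alpha(\beta)=[\alpha,\beta]_{\mathfrak h}$, $\mathrm{ad}^R_\alpha(\beta)=[\beta,\alpha]_{\mathfrak h}$; $\mathrm{Der}^L(\mathfrak h)=\{D\in\mathfrak{gl}(\mathfrak h): D[\alpha,\beta]_{\mathfrak h}=[D\alpha,\beta]_{\mathfrak h}+[\alpha,D\beta]_{\mathfrak h}\}$; $\mathrm{Der}^R(\mathfrak h)=\{D\in\mathfrak{gl}(\mathfrak h): D[\alpha,\beta]_{\mathfrak h}=[\alpha,D\beta]_{\mathfrak h}-[\beta,D\alpha]_{\mathfrak h}\}$; $\Delta(\mathfrak h)=\mathrm{span}\{[\alpha,\alpha]_{\mathfrak h}:\alpha\in\mathfrak h\}$; $\Pi(\mathfrak h)=\{(D^L,D^R)\in\mathrm{Der}^L(\mathfrak h)\oplus\mathrm{Der}^R(\mathfrak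 h): D^L\alpha+D^R\alpha\in\Delta(\mathfrak h)\ \forall\alpha\}$. When $\mathfrak h$ is a Lie algebra, $\mathrm{Der}(\mathfrak h)$ is its space of derivations, $\Delta(\mathfrak h)=0$ and $\Pi(\mathfrak h)=\{(D,-D):D\in\mathrm{Der}(\mathfrak h)\}$. A strict Leibniz 2-algebra $(V_1,V_0,\mathrm d,l_2)$ consists of a linear map $\mathrm d:V_1\to V_0$ and bilinear maps $l_2:V_i\times V_j\to V_{i+j}$ ($0\le i+j\le1$) such that for $x\in V_0$, $m,n\in V_1$: $\mathrm dl_2(x,m)=l_2(x,\mathrm dm)$, $\mathrm dl_2(m,x)=l_2(\mathrm dm,x)$, $l_2(\mathrm dm,n)=l_2(m,\mathrm dn)$, and the Leibniz identity $l_2(a,l_2(b,c))=l_2(l_2(a,b),c)+l_2(b,l_2(a,c))$ holds whenever $a,b,c$ all lie in $V_0$ or exactly one of them lies in $V_1$ and the others in $V_0$. It is a (strict) Lie 2-algebra if moreover $l_2$ is skewsymmetric. $(\mathfrak h,\mathrm{Der}(\mathfrak h),\mathrm{ad},l_2)$: $V_1=\mathfrak h$, $V_0=\mathrm{Der}(\mathfrak h)$, $\mathrm d=\mathrm{ad}$, $l_2(D_1,D_2)=[D_1,D_2]=D_1D_2-D_2D_1$, $l_2(D,\alpha)=-l_2(\alpha,D)=D\alpha$. $(\mathfrak h,\Pi(\mathfrak h),(\mathrm{ad}^L,\mathrm{ad}^R),l_2)$: $V_1=\mathfrak h$, $V_0=\Pi(\mathfrak h)$, $\mathrm d\alpha=(\mathrm{ad}^L_\alpha,\mathrm{ad}^R_\alpha)$,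 $l_2((D^L_1,D^R_1),(D^L_2,D^R_2))=([D^L_1,D^L_2],[D^L_1,D^R_2])$, $l_2((D^L,D^R),\alpha)=D^L\alpha$, $l_2(\alpha,(D^L,D^R))=D^R\alpha$. A morphism between strict Leibniz (or Lie) 2-algebras $\mathcal V\to\mathcal V'$ consists of linear maps $f_0:V_0\to V_0'$, $f_1:V_1\to V_1'$ with $f_0\circ\mathrm d=\mathrm d'\circ f_1$, and a bilinear map $f_2:V_0\times V_0\to V_1'$ such that $l_2'(f_0(x),f_0(y))-f_0l_2(x,y)=\mathrm d'f_2(x,y)$, $l_2'(f_0(x),f_1(m))-f_1l_2(x,m)=f_2(x,\mathrm dm)$, $l_2'(f_1(m),f_0(x))-f_1l_2(m,x)=f_2(\mathrm dm,x)$ and $l_2'(f_0(x),f_2(y,z))-l_2'(f_0(y),f_2(x,z))-l_2'(f_2(x,y),f_0(z))-f_2(l_2(x,y),z)+f_2(x,l_2(y,z))-f_2(y,l_2(x,z))=0$ for all $x,y,z\in V_0$, $m\in V_1$. It is an isomorphism if $f_0$ and $f_1$ are invertible. *)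

theory Defs
  imports "HOL-Library.Function_Algebras" "HOL-Analysis.Product_Vector"
begin

section \<open>Leibniz algebras, Lie algebras and their derivations\<close>

text \<open>Left Leibniz algebras over the field \<open>'k\<close>; the underlying vector space is the type \<open>'h\<close>
  with scalar multiplication \<open>smul\<close>.\<close>

locale leibniz_algebra = vector_space smul
  for smul :: "'k::field \<Rightarrow> 'h::ab_group_add \<Rightarrow> 'h" +
  fixes bracket :: "'h \<Rightarrow> 'h \<Rightarrow> 'h"
  assumes bracket_linear_right: "Vector_Spaces.linear smul smul (\<lambda>y. bracket x y)"
    and bracket_linear_left: "Vector_Spaces.linear smul smul (\<lambda>x. bracket x y)"
    and leibniz: "bracket x (bracket y z) = bracket (bracket x y) z + bracket y (bracket x z)"

text \<open>For an alternating bracket the left Leibniz identity is the Jacobi identity.\<close>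

locale lie_algebra = leibniz_algebra smul bracket
  for smul :: "'k::field \<Rightarrow> 'h::ab_group_add \<Rightarrow> 'h" and bracket :: "'h \<Rightarrow> 'h \<Rightarrow> 'h" +
  assumes alternating: "bracket x x = 0"

definition adL :: "('h \<Rightarrow> 'h \<Rightarrow> 'h) \<Rightarrow> 'h \<Rightarrow> 'h \<Rightarrow> 'h" where
  "adL bracket \<alpha> = (\<lambda>\<beta>. bracket \<alpha> \<beta>)"

definition adR :: "('h \<Rightarrow> 'h \<Rightarrow> 'h) \<Rightarrow> 'h \<Rightarrow> 'h \<Rightarrow> 'h" where
  "adR bracket \<alpha> = (\<lambda>\<beta>. bracket \<beta> \<alpha>)"

definition DerL :: "('k::field \<Rightarrow> 'h::ab_group_add \<Rightarrow> 'h) \<Rightarrow> ('h \<Rightarrow> 'h \<Rightarrow> 'h) \<Rightarrow> ('h \<Rightarrow> 'h) set" where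
  "DerL smul bracket = {D. Vector_Spaces.linear smul smul D \<and>
     (\<forall>\<alpha> \<beta>. D (bracket \<alpha> \<beta>) = bracket (D \<alpha>) \<beta> + bracket \<alpha> (D \<beta>))}"

definition DerR :: "('k::field \<Rightarrow> 'h::ab_group_add \<Rightarrow> 'h) \<Rightarrow> ('h \<Rightarrow> 'h \<Rightarrow> 'h) \<Rightarrow> ('h \<Rightarrow> 'h) set" where
  "DerR smul bracket = {D. Vector_Spaces.linear smul smul D \<and>
     (\<forall>\<alpha> \<beta>. D (bracket \<alpha> \<beta>) = bracket \<alpha> (D \<beta>) - bracket \<beta> (D \<alpha>))}"

text \<open>The derivations of a Lie algebra are its left derivations.\<close>

abbreviation Der :: "('k::field \<Rightarrow> 'h::ab_group_add \<Rightarrow> 'h) \<Rightarrow> ('h \<Rightarrow> 'h \<Rightarrow> 'h) \<Rightarrow> ('h \<Rightarrow> 'h) set" where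
  "Der \<equiv> DerL"

definition leib_kernel :: "('k::field \<Rightarrow> 'h::ab_group_add \<Rightarrow> 'h) \<Rightarrow> ('h \<Rightarrow> 'h \<Rightarrow> 'h) \<Rightarrow> 'h set" where
  "leib_kernel smul bracket = module.span smul {bracket \<alpha> \<alpha> | \<alpha>. True}"

definition Pi_der :: "('k::field \<Rightarrow> 'h::ab_group_add \<Rightarrow> 'h) \<Rightarrow> ('h \<Rightarrow> 'h \<Rightarrow> 'h)
    \<Rightarrow> (('h \<Rightarrow> 'h) \<times> ('h \<Rightarrow> 'h)) set" where
  "Pi_der smul bracket = {(DL, DR). DL \<in> DerL smul bracket \<and> DR \<in> DerR smul bracket \<and>
     (\<forall>\<alpha>. DL \<alpha> + DR \<alpha> \<in> leib_kernel smul bracket)}"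

definition commutator :: "('h::ab_group_add \<Rightarrow> 'h) \<Rightarrow> ('h \<Rightarrow> 'h) \<Rightarrow> 'h \<Rightarrow> 'h" where
  "commutator A B = (A \<circ> B) - (B \<circ> A)"


section \<open>Strict Leibniz 2-algebras\<close>

text \<open>Linear maps between subspaces \<open>A\<close>, \<open>B\<close> of vector spaces with scalar multiplications
  \<open>sA\<close>, \<open>sB\<close>. Values outside \<open>A\<close> are unconstrained.\<close>

definition linear_btw :: "('k \<Rightarrow> 'a \<Rightarrow> 'a) \<Rightarrow> ('k \<Rightarrow> 'b \<Rightarrow> 'b) \<Rightarrow> 'a::ab_group_add set
    \<Rightarrow> 'b::ab_group_add set \<Rightarrow> ('a \<Rightarrow> 'b) \<Rightarrow> bool" where
  "linear_btw sA sB A B f \<longleftrightarrow> f ` A \<subseteq> B \<and>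
     (\<forall>x\<in>A. \<forall>y\<in>A. f (x + y) = f x + f y) \<and>
     (\<forall>c. \<forall>x\<in>A. f (sA c x) = sB c (f x))"

definition bilinear_btw :: "('k \<Rightarrow> 'a \<Rightarrow> 'a) \<Rightarrow> ('k \<Rightarrow> 'b \<Rightarrow> 'b) \<Rightarrow> ('k \<Rightarrow> 'c \<Rightarrow> 'c)
    \<Rightarrow> 'a::ab_group_add set \<Rightarrow> 'b::ab_group_add set \<Rightarrow> 'c::ab_group_add set
    \<Rightarrow> ('a \<Rightarrow> 'b \<Rightarrow> 'c) \<Rightarrow> bool" where
  "bilinear_btw sA sB sC A B C f \<longleftrightarrow>
     (\<forall>x\<in>A. linear_btw sB sC B C (\<lambda>y. f x y)) \<and>
     (\<forall>y\<in>B. linear_btw sA sC A C (\<lambda>x. f x y))"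

text \<open>The spaces \<open>V0\<close>, \<open>V1\<close> are subspaces of ambient vector spaces with scalar multiplications
  \<open>sc0\<close>, \<open>sc1\<close>. The components \<open>l00\<close>, \<open>l01\<close>, \<open>l10\<close> are the restrictions of \<open>l\<^sub>2\<close> to
  \<open>V0 \<times> V0\<close>, \<open>V0 \<times> V1\<close>, \<open>V1 \<times> V0\<close>.\<close>

record ('k, 'a, 'b) two_term =
  V0 :: "'a set"
  sc0 :: "'k \<Rightarrow> 'a \<Rightarrow> 'a"
  V1 :: "'b set"
  sc1 :: "'k \<Rightarrow> 'b \<Rightarrow> 'b"
  dd :: "'b \<Rightarrow> 'a"
  l00 :: "'a \<Rightarrow> 'a \<Rightarrow> 'a"
  l01 :: "'a \<Rightarrow> 'b \<Rightarrow> 'b"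
  l10 :: "'b \<Rightarrow> 'a \<Rightarrow> 'b"

definition strict_leibniz_2_algebra ::
    "('k::field, 'a::ab_group_add, 'b::ab_group_add) two_term \<Rightarrow> bool" where
  "strict_leibniz_2_algebra \<V> \<longleftrightarrow>
     vector_space (sc0 \<V>) \<and> module.subspace (sc0 \<V>) (V0 \<V>) \<and>
     vector_space (sc1 \<V>) \<and> module.subspace (sc1 \<V>) (V1 \<V>) \<and>
     linear_btw (sc1 \<V>) (sc0 \<V>) (V1 \<V>) (V0 \<V>) (dd \<V>) \<and>
     bilinear_btw (sc0 \<V>) (sc0 \<V>) (sc0 \<V>) (V0 \<V>) (V0 \<V>) (V0 \<V>) (l00 \<V>) \<and>
     bilinear_btw (sc0 \<V>) (sc1 \<V>) (sc1 \<V>) (V0 \<V>) (V1 \<V>) (V1 \<V>) (l01 \<V>) \<and>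
     bilinear_btw (sc1 \<V>) (sc0 \<V>) (sc1 \<V>) (V1 \<V>) (V0 \<V>) (V1 \<V>) (l10 \<V>) \<and>
     (\<forall>x\<in>V0 \<V>. \<forall>m\<in>V1 \<V>. dd \<V> (l01 \<V> x m) = l00 \<V> x (dd \<V> m)) \<and>
     (\<forall>x\<in>V0 \<V>. \<forall>m\<in>V1 \<V>. dd \<V> (l10 \<V> m x) = l00 \<V> (dd \<V> m) x) \<and>
     (\<forall>m\<in>V1 \<V>. \<forall>n\<in>V1 \<V>. l01 \<V> (dd \<V> m) n = l10 \<V> m (dd \<V> n)) \<and>
     (\<forall>x\<in>V0 \<V>. \<forall>y\<in>V0 \<V>. \<forall>z\<in>V0 \<V>.
        l00 \<V> x (l00 \<V> y z) = l00 \<V> (l00 \<V> x y) z + l00 \<V> y (l00 \<V> x z)) \<and>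
     (\<forall>x\<in>V0 \<V>. \<forall>y\<in>V0 \<V>. \<forall>m\<in>V1 \<V>.
        l01 \<V> x (l01 \<V> y m) = l01 \<V> (l00 \<V> x y) m + l01 \<V> y (l01 \<V> x m)) \<and>
     (\<forall>x\<in>V0 \<V>. \<forall>m\<in>V1 \<V>. \<forall>y\<in>V0 \<V>.
        l01 \<V> x (l10 \<V> m y) = l10 \<V> (l01 \<V> x m) y + l10 \<V> m (l00 \<V> x y)) \<and>
     (\<forall>m\<in>V1 \<V>. \<forall>x\<in>V0 \<V>. \<forall>y\<in>V0 \<V>.
        l10 \<V> m (l00 \<V> x y) = l10 \<V> (l10 \<V> m x) y + l01 \<V> x (l10 \<V> m y))"

definition strict_lie_2_algebra ::
    "('k::field, 'a::ab_group_add, 'b::ab_group_add) two_term \<Rightarrow> bool" where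
  "strict_lie_2_algebra \<V> \<longleftrightarrow> strict_leibniz_2_algebra \<V> \<and>
     (\<forall>x\<in>V0 \<V>. \<forall>y\<in>V0 \<V>. l00 \<V> x y = - l00 \<V> y x) \<and>
     (\<forall>x\<in>V0 \<V>. \<forall>m\<in>V1 \<V>. l01 \<V> x m = - l10 \<V> m x)"

definition two_algebra_morphism ::
    "('k::field, 'a::ab_group_add, 'b::ab_group_add) two_term
     \<Rightarrow> ('k, 'c::ab_group_add, 'd::ab_group_add) two_term
     \<Rightarrow> ('a \<Rightarrow> 'c) \<Rightarrow> ('b \<Rightarrow> 'd) \<Rightarrow> ('a \<Rightarrow> 'a \<Rightarrow> 'd) \<Rightarrow> bool" where
  "two_algebra_morphism \<V> \<W> f0 f1 f2 \<longleftrightarrow>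
     strict_leibniz_2_algebra \<V> \<and> strict_leibniz_2_algebra \<W> \<and>
     linear_btw (sc0 \<V>) (sc0 \<W>) (V0 \<V>) (V0 \<W>) f0 \<and>
     linear_btw (sc1 \<V>) (sc1 \<W>) (V1 \<V>) (V1 \<W>) f1 \<and>
     bilinear_btw (sc0 \<V>) (sc0 \<V>) (sc1 \<W>) (V0 \<V>) (V0 \<V>) (V1 \<W>) f2 \<and>
     (\<forall>m\<in>V1 \<V>. f0 (dd \<V> m) = dd \<W> (f1 m)) \<and>
     (\<forall>x\<in>V0 \<V>. \<forall>y\<in>V0 \<V>. l00 \<W> (f0 x) (f0 y) - f0 (l00 \<V> x y) = dd \<W> (f2 x y)) \<and>
     (\<forall>x\<in>V0 \<V>. \<forall>m\<in>V1 \<V>. l01 \<W> (f0 x) (f1 m) - f1 (l01 \<V> x m) = f2 x (dd \<V> m)) \<and>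
     (\<forall>x\<in>V0 \<V>. \<forall>m\<in>V1 \<V>. l10 \<W> (f1 m) (f0 x) - f1 (l10 \<V> m x) = f2 (dd \<V> m) x) \<and>
     (\<forall>x\<in>V0 \<V>. \<forall>y\<in>V0 \<V>. \<forall>z\<in>V0 \<V>.
        l01 \<W> (f0 x) (f2 y z) - l01 \<W> (f0 y) (f2 x z) - l10 \<W> (f2 x y) (f0 z)
        - f2 (l00 \<V> x y) z + f2 x (l00 \<V> y z) - f2 y (l00 \<V> x z) = 0)"

definition two_algebra_isomorphism ::
    "('k::field, 'a::ab_group_add, 'b::ab_group_add) two_term
     \<Rightarrow> ('k, 'c::ab_group_add, 'd::ab_group_add) two_term
     \<Rightarrow> ('a \<Rightarrow> 'c) \<Rightarrow> ('b \<Rightarrow> 'd) \<Rightarrow> ('a \<Rightarrow> 'a \<Rightarrow> 'd) \<Rightarrow> bool" where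
  "two_algebra_isomorphism \<V> \<W> f0 f1 f2 \<longleftrightarrow> two_algebra_morphism \<V> \<W> f0 f1 f2 \<and>
     bij_betw f0 (V0 \<V>) (V0 \<W>) \<and> bij_betw f1 (V1 \<V>) (V1 \<W>)"


section \<open>The 2-algebras of derivations\<close>

definition scale_fun :: "('k \<Rightarrow> 'h \<Rightarrow> 'h) \<Rightarrow> 'k \<Rightarrow> ('h \<Rightarrow> 'h) \<Rightarrow> 'h \<Rightarrow> 'h" where
  "scale_fun smul c f = (\<lambda>x. smul c (f x))"

definition Der_2_algebra :: "('k::field \<Rightarrow> 'h::ab_group_add \<Rightarrow> 'h) \<Rightarrow> ('h \<Rightarrow> 'h \<Rightarrow> 'h)
    \<Rightarrow> ('k, 'h \<Rightarrow> 'h, 'h) two_term" where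
  "Der_2_algebra smul bracket =
    \<lparr> V0 = Der smul bracket, sc0 = scale_fun smul,
      V1 = UNIV, sc1 = smul,
      dd = adL bracket,
      l00 = commutator,
      l01 = (\<lambda>D \<alpha>. D \<alpha>),
      l10 = (\<lambda>\<alpha> D. - D \<alpha>) \<rparr>"

definition Pi_2_algebra :: "('k::field \<Rightarrow> 'h::ab_group_add \<Rightarrow> 'h) \<Rightarrow> ('h \<Rightarrow> 'h \<Rightarrow> 'h)
    \<Rightarrow> ('k, ('h \<Rightarrow> 'h) \<times> ('h \<Rightarrow> 'h), 'h) two_term" where
  "Pi_2_algebra smul bracket =
    \<lparr> V0 = Pi_der smul bracket, sc0 = module_prod.scale (scale_fun smul) (scale_fun smul),
      V1 = UNIV, sc1 = smul,
      dd = (\<lambda>\<alpha>. (adL bracket \<alpha>, adR bracket \<alpha>)),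
      l00 = (\<lambda>(DL1, DR1) (DL2, DR2). (commutator DL1 DL2, commutator DL1 DR2)),
      l01 = (\<lambda>(DL, DR) \<alpha>. DL \<alpha>),
      l10 = (\<lambda>\<alpha> (DL, DR). DR \<alpha>) \<rparr>"

end

theory Submission
  imports Defs
begin

text \<open>
  For a Lie algebra the squares \<open>[\<alpha>, \<alpha>]\<close> vanish, so the Leibniz kernel \<open>\<Delta>\<close> is zero and a pair in
  \<open>\<Pi>\<close> has the form \<open>(D, - D)\<close>. By skew symmetry of the bracket, the right derivation condition for
  \<open>- D\<close> says exactly that \<open>D\<close> is a derivation. Hence \<open>\<Pi>\<close> is the bijective image of \<open>Der\<close> under
  \<open>f\<^sub>0 D = (D, - D)\<close> (\<open>Pi_der_eq\<close>).

  The pair \<open>(f\<^sub>0, id)\<close> also matches the structure maps on the nose: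
  \<open>(ad\<^sup>L, ad\<^sup>R) = (ad, - ad)\<close> by skew symmetry, \<open>[D, - E] = - [D, E]\<close>, and the two actions of
  \<open>(D, - D)\<close> on \<open>\<alpha>\<close> are \<open>D \<alpha>\<close> and \<open>- D \<alpha>\<close>. So it is enough to verify the axioms for the
  derivation 2-algebra (\<open>strict_lie_2_algebra_Der\<close>). They pass to the other one because identities
  pass to the image of a surjective map that preserves all operations
  (\<open>strict_lie_2_algebra_surj_image\<close>); such a map is a morphism with \<open>f\<^sub>2 = 0\<close>, since then every
  defect that \<open>f\<^sub>2\<close> measures is zero.
\<close>

section \<open>Images under surjective strict morphisms\<close>

lemma strict_leibniz_2_algebra_closed:
  assumes "strict_leibniz_2_algebra \<V>"
  shows "m \<in> V1 \<V> \<Longrightarrow> dd \<V> m \<in> V0 \<V>"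
    and "x \<in> V0 \<V> \<Longrightarrow> y \<in> V0 \<V> \<Longrightarrow> l00 \<V> x y \<in> V0 \<V>"
    and "x \<in> V0 \<V> \<Longrightarrow> m \<in> V1 \<V> \<Longrightarrow> l01 \<V> x m \<in> V1 \<V>"
    and "x \<in> V0 \<V> \<Longrightarrow> m \<in> V1 \<V> \<Longrightarrow> l10 \<V> m x \<in> V1 \<V>"
  using assms
  unfolding strict_leibniz_2_algebra_def bilinear_btw_def linear_btw_def
  by (simp_all add: image_subset_iff)

lemma linear_btw_subspace_image:
  fixes sA :: "'k::field \<Rightarrow> 'a::ab_group_add \<Rightarrow> 'a" and sB :: "'k \<Rightarrow> 'b::ab_group_add \<Rightarrow> 'b"
  assumes "vector_space sA" "vector_space sB" "module.subspace sA A" "linear_btw sA sB A B f"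
  shows "module.subspace sB (f ` A)"
proof -
  interpret A: vector_space sA by fact
  interpret B: vector_space sB by fact
  have add: "f (x + y) = f x + f y" and scale: "f (sA c x) = sB c (f x)"
    if "x \<in> A" "y \<in> A" for x y c
    using assms(4) that by (auto simp: linear_btw_def)
  have 0: "0 \<in> A"
    using assms(3) by (rule A.subspace_0)
  have "f 0 = 0"
    using scale[OF 0 0, of 0] by simp
  then have "0 \<in> f ` A"
    using 0 by force
  moreover have "f x + f y \<in> f ` A" if "x \<in> A" "y \<in> A" for x y
    using A.subspace_add[OF assms(3)] that by (simp flip: add)
  moreover have "sB c (f x) \<in> f ` A" if "x \<in> A" for c x
    using A.subspace_scale[OF assms(3)] that by (simp flip: scale[OF that that])
  ultimately show ?thesis
    unfolding B.subspace_def by blast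
qed

lemma bilinear_btw_zero:
  fixes sC :: "'k::field \<Rightarrow> 'c::ab_group_add \<Rightarrow> 'c"
  assumes "vector_space sC" "0 \<in> C"
  shows "bilinear_btw sA sB sC A B C (\<lambda>_ _. 0)"
proof -
  interpret vector_space sC by fact
  show ?thesis using assms by (auto simp: bilinear_btw_def linear_btw_def)
qed

text \<open>Here \<open>g\<close> is the map that \<open>f\<close> induces along the surjection \<open>p\<close>. Sums and multiples of elements
  of \<open>A'\<close> are computed on preimages, so linearity descends from \<open>f\<close> to \<open>g\<close>.\<close>

lemma linear_btw_surj_image:
  assumes "linear_btw sA sB A B f" "linear_btw sA sA' A A' p" "linear_btw sB sB' B B' q"
    and "\<And>x y. x \<in> A \<Longrightarrow> y \<in> A \<Longrightarrow> x + y \<in> A" and "\<And>c x. x \<in> A \<Longrightarrow> sA c x \<in> A"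
    and "\<And>x. x \<in> A \<Longrightarrow> g (p x) = q (f x)" and "p ` A = A'"
  shows "linear_btw sA' sB' A' B' g"
proof -
  have eqs: "g (p x + p y) = g (p x) + g (p y)" "g (sA' c (p x)) = sB' c (g (p x))" "g (p x) \<in> B'"
    if xy: "x \<in> A" "y \<in> A" for x y c
  proof -
    have f: "f x \<in> B" "f y \<in> B" using assms(1) xy by (auto simp: linear_btw_def)
    have p: "p x + p y = p (x + y)" "sA' c (p x) = p (sA c x)"
      using assms(2) xy by (auto simp: linear_btw_def)
    show "g (p x + p y) = g (p x) + g (p y)" "g (sA' c (p x)) = sB' c (g (p x))" "g (p x) \<in> B'"
      using assms(1,3) f xy unfolding p
      by (auto simp: linear_btw_def assms(4-6))
  qed
  then show ?thesis
    unfolding linear_btw_def assms(7)[symmetric] by blast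
qed

lemma bilinear_btw_surj_image:
  assumes f: "bilinear_btw sA sB sC A B C f"
    and p: "linear_btw sA sA' A A' p" "p ` A = A'"
    and q: "linear_btw sB sB' B B' q" "q ` B = B'"
    and r: "linear_btw sC sC' C C' r"
    and A: "\<And>x y. x \<in> A \<Longrightarrow> y \<in> A \<Longrightarrow> x + y \<in> A" "\<And>c x. x \<in> A \<Longrightarrow> sA c x \<in> A"
    and B: "\<And>x y. x \<in> B \<Longrightarrow> y \<in> B \<Longrightarrow> x + y \<in> B" "\<And>c x. x \<in> B \<Longrightarrow> sB c x \<in> B"
    and g: "\<And>x y. x \<in> A \<Longrightarrow> y \<in> B \<Longrightarrow> g (p x) (q y) = r (f x y)"
  shows "bilinear_btw sA' sB' sC' A' B' C' g"
proof -
  have "linear_btw sB' sC' B' C' (g (p x))" if "x \<in> A" for x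
    using that f
    by (intro linear_btw_surj_image[where f = "f x" and p = q and q = r, OF _ q(1) r B g q(2)])
      (auto simp: bilinear_btw_def)
  moreover have "linear_btw sA' sC' A' C' (\<lambda>x. g x (q y))" if "y \<in> B" for y
    using that f
    by (intro linear_btw_surj_image[where f = "\<lambda>x. f x y" and p = p and q = r, OF _ p(1) r A g p(2)])
      (auto simp: bilinear_btw_def)
  ultimately show ?thesis
    unfolding bilinear_btw_def p(2)[symmetric] q(2)[symmetric] by blast
qed

text \<open>Every element of \<open>\<W>\<close> is the image of an element of \<open>\<V>\<close>, so each axiom for \<open>\<W>\<close> is the image of
  the corresponding axiom for \<open>\<V>\<close>.\<close>

lemma strict_lie_2_algebra_surj_image:
  fixes \<V> :: "('k::field, 'a::ab_group_add, 'b::ab_group_add) two_term"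
    and \<W> :: "('k, 'c::ab_group_add, 'd::ab_group_add) two_term"
  assumes \<V>: "strict_lie_2_algebra \<V>"
    and vs: "vector_space (sc0 \<W>)" "vector_space (sc1 \<W>)"
    and f0: "linear_btw (sc0 \<V>) (sc0 \<W>) (V0 \<V>) (V0 \<W>) f0" "f0 ` V0 \<V> = V0 \<W>"
    and f1: "linear_btw (sc1 \<V>) (sc1 \<W>) (V1 \<V>) (V1 \<W>) f1" "f1 ` V1 \<V> = V1 \<W>"
    and dd: "\<And>m. m \<in> V1 \<V> \<Longrightarrow> dd \<W> (f1 m) = f0 (dd \<V> m)"
    and l00: "\<And>x y. x \<in> V0 \<V> \<Longrightarrow> y \<in> V0 \<V> \<Longrightarrow> l00 \<W> (f0 x) (f0 y) = f0 (l00 \<V> x y)"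
    and l01: "\<And>x m. x \<in> V0 \<V> \<Longrightarrow> m \<in> V1 \<V> \<Longrightarrow> l01 \<W> (f0 x) (f1 m) = f1 (l01 \<V> x m)"
    and l10: "\<And>m x. m \<in> V1 \<V> \<Longrightarrow> x \<in> V0 \<V> \<Longrightarrow> l10 \<W> (f1 m) (f0 x) = f1 (l10 \<V> m x)"
  shows "strict_lie_2_algebra \<W>" (is ?lie)
    and "two_algebra_morphism \<V> \<W> f0 f1 (\<lambda>_ _. 0)" (is ?mor)
proof -
  have leib: "strict_leibniz_2_algebra \<V>"
    using \<V> by (simp add: strict_lie_2_algebra_def)
  note V = leib[unfolded strict_leibniz_2_algebra_def]
  note closed = strict_leibniz_2_algebra_closed[OF leib]
  interpret V0: vector_space "sc0 \<V>" using V by blast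
  interpret V1: vector_space "sc1 \<V>" using V by blast
  interpret W0: vector_space "sc0 \<W>" by fact
  interpret W1: vector_space "sc1 \<W>" by fact
  have sub: "V0.subspace (V0 \<V>)" "V1.subspace (V1 \<V>)"
    using V by blast+
  have subW: "W0.subspace (V0 \<W>)" "W1.subspace (V1 \<W>)"
    using linear_btw_subspace_image[OF V0.vector_space_axioms vs(1) sub(1) f0(1)]
      linear_btw_subspace_image[OF V1.vector_space_axioms vs(2) sub(2) f1(1)] f0(2) f1(2) by simp_all
  note c0 = V0.subspace_add[OF sub(1)] V0.subspace_scale[OF sub(1)]
  note c1 = V1.subspace_add[OF sub(2)] V1.subspace_scale[OF sub(2)]
  have f0_add: "f0 x + f0 y = f0 (x + y)" if "x \<in> V0 \<V>" "y \<in> V0 \<V>" for x y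
    using f0(1) that by (simp add: linear_btw_def)
  have f1_add: "f1 x + f1 y = f1 (x + y)" if "x \<in> V1 \<V>" "y \<in> V1 \<V>" for x y
    using f1(1) that by (simp add: linear_btw_def)
  have f0_minus: "- f0 x = f0 (- x)" if "x \<in> V0 \<V>" for x
    using f0(1) that W0.scale_minus_left[of 1] V0.scale_minus_left[of 1]
    by (metis V0.scale_one W0.scale_one linear_btw_def)
  have f1_minus: "- f1 x = f1 (- x)" if "x \<in> V1 \<V>" for x
    using f1(1) that W1.scale_minus_left[of 1] V1.scale_minus_left[of 1]
    by (metis V1.scale_one W1.scale_one linear_btw_def)
  have lin_dd: "linear_btw (sc1 \<W>) (sc0 \<W>) (V1 \<W>) (V0 \<W>) (dd \<W>)"
    using V by (intro linear_btw_surj_image[where f = "dd \<V>" and p = f1 and q = f0,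
        OF _ f1(1) f0(1) c1 dd f1(2)]) blast+
  have bil_l00: "bilinear_btw (sc0 \<W>) (sc0 \<W>) (sc0 \<W>) (V0 \<W>) (V0 \<W>) (V0 \<W>) (l00 \<W>)"
    using V by (intro bilinear_btw_surj_image[where f = "l00 \<V>" and p = f0 and q = f0 and r = f0,
        OF _ f0 f0 f0(1) c0 c0 l00]) blast+
  have bil_l01: "bilinear_btw (sc0 \<W>) (sc1 \<W>) (sc1 \<W>) (V0 \<W>) (V1 \<W>) (V1 \<W>) (l01 \<W>)"
    using V by (intro bilinear_btw_surj_image[where f = "l01 \<V>" and p = f0 and q = f1 and r = f1,
        OF _ f0 f1 f1(1) c0 c1 l01]) blast+
  have bil_l10: "bilinear_btw (sc1 \<W>) (sc0 \<W>) (sc1 \<W>) (V1 \<W>) (V0 \<W>) (V1 \<W>) (l10 \<W>)"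
    using V by (intro bilinear_btw_surj_image[where f = "l10 \<V>" and p = f1 and q = f0 and r = f1,
        OF _ f1 f0 f1(1) c1 c0 l10]) blast+
  \<comment> \<open>Pulling \<open>f0\<close> and \<open>f1\<close> out of both sides leaves the identity for \<open>\<V>\<close> inside.\<close>
  have eqs:
    "dd \<W> (l01 \<W> (f0 x) (f1 m)) = l00 \<W> (f0 x) (dd \<W> (f1 m))"
    "dd \<W> (l10 \<W> (f1 m) (f0 x)) = l00 \<W> (dd \<W> (f1 m)) (f0 x)"
    "l01 \<W> (dd \<W> (f1 m)) (f1 n) = l10 \<W> (f1 m) (dd \<W> (f1 n))"
    "l00 \<W> (f0 x) (l00 \<W> (f0 y) (f0 z)) =
      l00 \<W> (l00 \<W> (f0 x) (f0 y)) (f0 z) + l00 \<W> (f0 y) (l00 \<W> (f0 x) (f0 z))"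
    "l01 \<W> (f0 x) (l01 \<W> (f0 y) (f1 m)) =
      l01 \<W> (l00 \<W> (f0 x) (f0 y)) (f1 m) + l01 \<W> (f0 y) (l01 \<W> (f0 x) (f1 m))"
    "l01 \<W> (f0 x) (l10 \<W> (f1 m) (f0 y)) =
      l10 \<W> (l01 \<W> (f0 x) (f1 m)) (f0 y) + l10 \<W> (f1 m) (l00 \<W> (f0 x) (f0 y))"
    "l10 \<W> (f1 m) (l00 \<W> (f0 x) (f0 y)) =
      l10 \<W> (l10 \<W> (f1 m) (f0 x)) (f0 y) + l01 \<W> (f0 x) (l10 \<W> (f1 m) (f0 y))"
    if mem: "x \<in> V0 \<V>" "y \<in> V0 \<V>" "z \<in> V0 \<V>" "m \<in> V1 \<V>" "n \<in> V1 \<V>" for x y z m n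
  proof -
    have
      "dd \<V> (l01 \<V> x m) = l00 \<V> x (dd \<V> m)"
      "dd \<V> (l10 \<V> m x) = l00 \<V> (dd \<V> m) x"
      "l01 \<V> (dd \<V> m) n = l10 \<V> m (dd \<V> n)"
      "l00 \<V> x (l00 \<V> y z) = l00 \<V> (l00 \<V> x y) z + l00 \<V> y (l00 \<V> x z)"
      "l01 \<V> x (l01 \<V> y m) = l01 \<V> (l00 \<V> x y) m + l01 \<V> y (l01 \<V> x m)"
      "l01 \<V> x (l10 \<V> m y) = l10 \<V> (l01 \<V> x m) y + l10 \<V> m (l00 \<V> x y)"
      "l10 \<V> m (l00 \<V> x y) = l10 \<V> (l10 \<V> m x) y + l01 \<V> x (l10 \<V> m y)"
      using V mem by blast+
    then show
      "dd \<W> (l01 \<W> (f0 x) (f1 m)) = l00 \<W> (f0 x) (dd \<W> (f1 m))"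
      "dd \<W> (l10 \<W> (f1 m) (f0 x)) = l00 \<W> (dd \<W> (f1 m)) (f0 x)"
      "l01 \<W> (dd \<W> (f1 m)) (f1 n) = l10 \<W> (f1 m) (dd \<W> (f1 n))"
      "l00 \<W> (f0 x) (l00 \<W> (f0 y) (f0 z)) =
        l00 \<W> (l00 \<W> (f0 x) (f0 y)) (f0 z) + l00 \<W> (f0 y) (l00 \<W> (f0 x) (f0 z))"
      "l01 \<W> (f0 x) (l01 \<W> (f0 y) (f1 m)) =
        l01 \<W> (l00 \<W> (f0 x) (f0 y)) (f1 m) + l01 \<W> (f0 y) (l01 \<W> (f0 x) (f1 m))"
      "l01 \<W> (f0 x) (l10 \<W> (f1 m) (f0 y)) =
        l10 \<W> (l01 \<W> (f0 x) (f1 m)) (f0 y) + l10 \<W> (f1 m) (l00 \<W> (f0 x) (f0 y))"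
      "l10 \<W> (f1 m) (l00 \<W> (f0 x) (f0 y)) =
        l10 \<W> (l10 \<W> (f1 m) (f0 x)) (f0 y) + l01 \<W> (f0 x) (l10 \<W> (f1 m) (f0 y))"
      using mem by (simp_all only: dd l00 l01 l10 closed c0(1) c1(1) f0_add f1_add)
  qed
  have skew:
    "l00 \<W> (f0 x) (f0 y) = - l00 \<W> (f0 y) (f0 x)"
    "l01 \<W> (f0 x) (f1 m) = - l10 \<W> (f1 m) (f0 x)"
    if mem: "x \<in> V0 \<V>" "y \<in> V0 \<V>" "m \<in> V1 \<V>" for x y m
  proof -
    have "l00 \<V> x y = - l00 \<V> y x" "l01 \<V> x m = - l10 \<V> m x"
      using \<V> mem unfolding strict_lie_2_algebra_def by blast+
    then show
      "l00 \<W> (f0 x) (f0 y) = - l00 \<W> (f0 y) (f0 x)"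
      "l01 \<W> (f0 x) (f1 m) = - l10 \<W> (f1 m) (f0 x)"
      using mem by (simp_all only: l00 l01 l10 closed f0_minus f1_minus)
  qed
  \<comment> \<open>Zero fills the argument slots of \<open>eqs\<close> that a given axiom does not mention.\<close>
  have leibW: "strict_leibniz_2_algebra \<W>"
    unfolding strict_leibniz_2_algebra_def
    apply (intro conjI vs subW lin_dd bil_l00 bil_l01 bil_l10)
    unfolding f0(2)[symmetric] f1(2)[symmetric] ball_simps(9)
    by (blast intro: eqs V0.subspace_0[OF sub(1)] V1.subspace_0[OF sub(2)])+
  show ?lie
    unfolding strict_lie_2_algebra_def f0(2)[symmetric] f1(2)[symmetric] ball_simps(9)
    using leibW by (blast intro: skew V0.subspace_0[OF sub(1)] V1.subspace_0[OF sub(2)])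
  have d0: "dd \<W> 0 = 0"
    using W1.subspace_0[OF subW(2)] lin_dd W0.scale_zero_left W1.scale_zero_left
    unfolding linear_btw_def by metis
  have l0: "l01 \<W> x 0 = 0" "l10 \<W> 0 x = 0" if "x \<in> V0 \<W>" for x
    using W1.subspace_0[OF subW(2)] bil_l01 bil_l10 W1.scale_zero_left that
    unfolding linear_btw_def bilinear_btw_def by metis+
  have "f0 x \<in> V0 \<W>" if "x \<in> V0 \<V>" for x
    using f0(2) that by blast
  then show ?mor
    unfolding two_algebra_morphism_def
    by (simp add: leib leibW f0(1) f1(1) dd l00 l01 l10 d0 l0
        bilinear_btw_zero[OF vs(2) W1.subspace_0[OF subW(2)]])
qed

section \<open>Derivations of a Lie algebra\<close>

lemma vector_space_scale_fun:
  assumes "vector_space smul"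
  shows "vector_space (scale_fun smul)"
proof -
  interpret vector_space smul by fact
  show ?thesis
    by unfold_locales
      (auto simp: scale_fun_def fun_eq_iff scale_right_distrib scale_left_distrib)
qed

lemma commutator_apply: "commutator A B x = A (B x) - B (A x)"
  by (simp add: commutator_def)

context leibniz_algebra
begin

lemma bracket_simps:
  "bracket (x + y) z = bracket x z + bracket y z"
  "bracket x (y + z) = bracket x y + bracket x z"
  "bracket (x - y) z = bracket x z - bracket y z"
  "bracket x (y - z) = bracket x y - bracket x z"
  "bracket (smul c x) z = smul c (bracket x z)"
  "bracket x (smul c z) = smul c (bracket x z)"
  "bracket (- x) z = - bracket x z"
  "bracket x (- z) = - bracket x z"
  "bracket 0 z = 0"
  "bracket x 0 = 0"
proof -
  interpret R: Vector_Spaces.linear smul smul "\<lambda>y. bracket x y" for x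
    by (rule bracket_linear_right)
  interpret L: Vector_Spaces.linear smul smul "\<lambda>x. bracket x y" for y
    by (rule bracket_linear_left)
  show
    "bracket (x + y) z = bracket x z + bracket y z"
    "bracket x (y + z) = bracket x y + bracket x z"
    "bracket (x - y) z = bracket x z - bracket y z"
    "bracket x (y - z) = bracket x y - bracket x z"
    "bracket (smul c x) z = smul c (bracket x z)"
    "bracket x (smul c z) = smul c (bracket x z)"
    "bracket (- x) z = - bracket x z"
    "bracket x (- z) = - bracket x z"
    "bracket 0 z = 0"
    "bracket x 0 = 0"
    by (simp_all only: L.add R.add L.diff R.diff L.scale R.scale L.neg R.neg L.zero R.zero)
qed

lemma linear_iff_add_scale:
  "Vector_Spaces.linear smul smul D \<longleftrightarrow>
    (\<forall>x y. D (x + y) = D x + D y) \<and> (\<forall>c x. D (smul c x) = smul c (D x))"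
  by (simp add: Vector_Spaces.linear_iff vector_space_axioms)

lemma DerD:
  assumes "D \<in> Der smul bracket"
  shows "D (x + y) = D x + D y" "D (smul c x) = smul c (D x)"
    "D (x - y) = D x - D y" "D (- x) = - D x" "D 0 = 0"
    "D (bracket x y) = bracket (D x) y + bracket x (D y)"
proof -
  interpret Vector_Spaces.linear smul smul D
    using assms by (simp add: DerL_def)
  show "D (x + y) = D x + D y" "D (smul c x) = smul c (D x)"
    "D (x - y) = D x - D y" "D (- x) = - D x" "D 0 = 0"
    by (rule add scale diff neg zero)+
  show "D (bracket x y) = bracket (D x) y + bracket x (D y)"
    using assms by (simp add: DerL_def)
qed

lemma subspace_Der: "module.subspace (scale_fun smul) (Der smul bracket)"
proof -
  interpret F: vector_space "scale_fun smul"
    by (rule vector_space_scale_fun) (rule vector_space_axioms)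
  have "0 \<in> Der smul bracket"
    by (simp add: DerL_def linear_iff_add_scale bracket_simps)
  moreover have "A + B \<in> Der smul bracket"
    if "A \<in> Der smul bracket" "B \<in> Der smul bracket" for A B
    using that
    by (simp add: DerL_def linear_iff_add_scale bracket_simps scale_right_distrib algebra_simps)
  moreover have "scale_fun smul c A \<in> Der smul bracket" if "A \<in> Der smul bracket" for A c
    using that
    by (simp add: DerL_def linear_iff_add_scale bracket_simps scale_fun_def scale_right_distrib
        mult.commute)
  ultimately show ?thesis
    unfolding F.subspace_def by blast
qed

lemma adL_in_Der: "adL bracket x \<in> Der smul bracket"
  unfolding DerL_def adL_def using bracket_linear_right leibniz by blast

lemma commutator_in_Der:
  assumes "A \<in> Der smul bracket" "B \<in> Der smul bracket"
  shows "commutator A B \<in> Der smul bracket"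
  by (simp add: DerL_def linear_iff_add_scale commutator_apply bracket_simps
      DerD[OF assms(1)] DerD[OF assms(2)] scale_right_diff_distrib)

end

context lie_algebra
begin

text \<open>Polarisation of \<open>[x + y, x + y] = 0\<close>, which is valid in every characteristic.\<close>

lemma bracket_skew: "bracket x y = - bracket y x"
  using alternating[of "x + y"]
  by (simp add: bracket_simps alternating[of x] alternating[of y] eq_neg_iff_add_eq_0 add.commute)

lemma leib_kernel_eq: "leib_kernel smul bracket = {0}"
proof -
  have "{bracket \<alpha> \<alpha> |\<alpha>. True} = {0}"
    by (auto simp: alternating)
  then show ?thesis
    by (simp add: leib_kernel_def)
qed

text \<open>By skew symmetry \<open>[x, - D y] - [y, - D x] = - ([D x, y] + [x, D y])\<close>, so the right derivation
  rule for \<open>- D\<close> is the negative of the derivation rule for \<open>D\<close>.\<close>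

lemma uminus_mem_DerR_iff: "- D \<in> DerR smul bracket \<longleftrightarrow> D \<in> Der smul bracket"
proof -
  have "(- D) (bracket x y) = bracket x ((- D) y) - bracket y ((- D) x) \<longleftrightarrow>
      D (bracket x y) = bracket (D x) y + bracket x (D y)" for x y
  proof -
    have "bracket x ((- D) y) - bracket y ((- D) x) = - (bracket (D x) y + bracket x (D y))"
      using bracket_skew[of y "D x"] by (simp add: bracket_simps)
    then show ?thesis
      by (simp only: uminus_apply neg_equal_iff_equal)
  qed
  moreover have "Vector_Spaces.linear smul smul (- D) \<longleftrightarrow> Vector_Spaces.linear smul smul D"
  proof -
    have "- D (x + y) = - D x - D y \<longleftrightarrow> D (x + y) = D x + D y" for x y
      using neg_equal_iff_equal[of "D (x + y)" "D x + D y"] by simp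
    then show ?thesis
      by (simp add: linear_iff_add_scale)
  qed
  ultimately show ?thesis
    by (simp add: DerL_def DerR_def)
qed

text \<open>As the Leibniz kernel vanishes, the first component of a pair determines the second.\<close>

lemma Pi_der_eq: "Pi_der smul bracket = (\<lambda>D. (D, - D)) ` Der smul bracket"
proof -
  have "(\<forall>\<alpha>. A \<alpha> + B \<alpha> \<in> leib_kernel smul bracket) \<longleftrightarrow> B = - A" for A B
    by (auto simp: leib_kernel_eq fun_eq_iff add_eq_0_iff)
  then show ?thesis
    by (auto simp: Pi_der_def leib_kernel_eq uminus_mem_DerR_iff)
qed

text \<open>The Leibniz identities on \<open>Der\<close> and its action on the algebra are the Jacobi identity for
  commutators and the module property of evaluation. Compatibility of \<open>d = ad\<close> with the action,
  \<open>[D, ad\<^sub>x] = ad\<^bsub>D x\<^esub>\<close>, is the derivation rule; the Peiffer identity is skew symmetry of the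
  bracket.\<close>

lemma strict_lie_2_algebra_Der: "strict_lie_2_algebra (Der_2_algebra smul bracket)"
proof -
  interpret F: vector_space "scale_fun smul"
    by (rule vector_space_scale_fun) (rule vector_space_axioms)
  show ?thesis
    unfolding strict_lie_2_algebra_def strict_leibniz_2_algebra_def Der_2_algebra_def
      linear_btw_def bilinear_btw_def
    by (auto simp: vector_space_axioms F.vector_space_axioms subspace_Der
        adL_in_Der[unfolded adL_def]
        commutator_in_Der commutator_apply fun_eq_iff DerD bracket_simps
        adL_def scale_fun_def scale_right_diff_distrib intro: bracket_skew)
qed

section \<open>Comparison of the two 2-algebras\<close>

lemma vector_space_prod_scale_fun: "vector_space_prod (scale_fun smul) (scale_fun smul)"
  using vector_space_scale_fun[OF vector_space_axioms]
  by (simp add: vector_space_prod_def vector_space_pair_def)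

lemma strict_lie_2_algebra_Pi: "strict_lie_2_algebra (Pi_2_algebra smul bracket)" (is ?lie)
  and two_algebra_morphism_Der_Pi: "two_algebra_morphism (Der_2_algebra smul bracket)
    (Pi_2_algebra smul bracket) (\<lambda>D. (D, - D)) id (\<lambda>_ _. 0)" (is ?mor)
proof -
  let ?D = "Der_2_algebra smul bracket" and ?P = "Pi_2_algebra smul bracket"
  interpret P: vector_space_prod "scale_fun smul" "scale_fun smul"
    by (rule vector_space_prod_scale_fun)
  have vs: "vector_space (sc0 ?P)" "vector_space (sc1 ?P)"
    by (simp_all add: Pi_2_algebra_def vector_space_axioms P.p.vector_space_axioms)
  have onto: "(\<lambda>D. (D, - D)) ` V0 ?D = V0 ?P"
    by (simp add: Pi_2_algebra_def Der_2_algebra_def Pi_der_eq)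
  have lin0: "linear_btw (sc0 ?D) (sc0 ?P) (V0 ?D) (V0 ?P) (\<lambda>D. (D, - D))"
    unfolding onto[symmetric]
    by (auto simp: linear_btw_def Pi_2_algebra_def Der_2_algebra_def P.scale_prod
        scale_fun_def fun_eq_iff)
  have lin1: "linear_btw (sc1 ?D) (sc1 ?P) (V1 ?D) (V1 ?P) id" "id ` V1 ?D = V1 ?P"
    by (simp_all add: linear_btw_def Pi_2_algebra_def Der_2_algebra_def)
  have d: "dd ?P (id m) = (\<lambda>D. (D, - D)) (dd ?D m)" for m
    by (auto simp: Pi_2_algebra_def Der_2_algebra_def adL_def adR_def fun_eq_iff
        intro: bracket_skew)
  have l00: "l00 ?P (A, - A) (B, - B) = (l00 ?D A B, - l00 ?D A B)"
    if "A \<in> V0 ?D" for A B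
    using that
    by (auto simp: Pi_2_algebra_def Der_2_algebra_def commutator_apply fun_eq_iff DerD)
  have l01_l10: "l01 ?P (D, - D) (id x) = id (l01 ?D D x)"
    "l10 ?P (id x) (D, - D) = id (l10 ?D x D)" for D x
    by (simp_all add: Pi_2_algebra_def Der_2_algebra_def)
  note image = strict_lie_2_algebra_surj_image
    [OF strict_lie_2_algebra_Der vs lin0 onto lin1 d l00 l01_l10]
  show ?lie ?mor
    using image by blast+
qed

end

theorem proposition3p7:
  fixes smul :: "'k::field \<Rightarrow> 'h::ab_group_add \<Rightarrow> 'h"
    and bracket :: "'h \<Rightarrow> 'h \<Rightarrow> 'h"
  assumes "lie_algebra smul bracket"
  shows "strict_lie_2_algebra (Der_2_algebra smul bracket) \<and>
    strict_lie_2_algebra (Pi_2_algebra smul bracket) \<and>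
    two_algebra_isomorphism (Der_2_algebra smul bracket) (Pi_2_algebra smul bracket)
      (\<lambda>D. (D, - D)) id (\<lambda>_ _. 0)"
proof -
  interpret lie_algebra smul bracket by fact
  have "bij_betw (\<lambda>D. (D, - D)) (Der smul bracket) (Pi_der smul bracket)"
    unfolding Pi_der_eq by (rule inj_on_imp_bij_betw) (simp add: inj_on_def)
  then have "two_algebra_isomorphism (Der_2_algebra smul bracket) (Pi_2_algebra smul bracket)
      (\<lambda>D. (D, - D)) id (\<lambda>_ _. 0)"
    using two_algebra_morphism_Der_Pi
    by (simp add: two_algebra_isomorphism_def Der_2_algebra_def Pi_2_algebra_def)
  then show ?thesis
    using strict_lie_2_algebra_Der strict_lie_2_algebra_Pi by blast
qed

end
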